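(* Let $\mathcal B$ be a blockchain, let $\mathit{Txs}$ be a finite sequence of transactions, and let $tx$ be a transaction. Suppose $\mathrm{valid}(\mathcal B;\mathit{Txs};tx)$ and $\mathrm{valid}(\mathcal B;tx)$. Then: (1) $\mathrm{valid}(\mathcal B;tx;\mathit{Txs})$, and (2) $\mathcal B;tx;\mathit{Txs}\cong\mathcal B;\mathit{Txs};tx$.
   Context: Idealised EUTxO. Fix a solution of the following type equations (the choice of the subset $\mathsf{Validator}$ is left unspecified): $\mathsf{Redeemer}=\mathsf{CurrencySymbol}=\mathsf{TokenName}=\mathsf{Position}=\mathbb N$; $\mathsf{Chip}=\mathsf{CurrencySymbol}\times\mathsf{TokenName}$; $\mathsf{Datum}=\mathbb N$; $\mathsf{Value}$ is the set of finite partial functions from $\mathsf{Chip}$ to $\mathbb N_{>0}$; $\mathsf{Validator}\subseteq \mathcal P(\mathsf{Redeemer}\times\mathsf{Datum}\times\mathsf{Value}\times\mathsf{Context})$, where $\mathcal P$ is powerset; $\mathsf{Input}=\mathsf{Position}\times\mathsf{Redeemer}$; $\mathsf{Output}=\mathsf{Position}\times\mathsf{Validator}\times\mathsf{Datum}\times\mathsf{Value}$; $\mathsf{Transaction}$ is the set of pairs $(I,O)$ with $I$ a finite subset of $\mathsf{Input}$ and $O$ a finite subset of $\mathsf{Output}$ (either may be empty); $\mathsf{Context}$ is the set of $((I,i),O)$ with $(I,O)\in\mathsf{Transaction}$ and $i\in I$. If $tx=(I,O)$ is a transaction and $i\in I$, write $tx@i$ for the context $((I,i),O)$. An input $i$ points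 to an output $o$ when $i$ and $o$ have the same position (first component). $\mathit{Txs}$ ranges over finite sequences of transactions; inputs and outputs appearing in $\mathit{Txs}$ are understood as occurrences (in a given transaction of the sequence), and "earlier"/"later" refer to strictly earlier/later transactions in the sequence. A (valid) blockchain is a finite sequence of transactions $\mathit{Txs}$ such that: (i) distinct outputs appearing in $\mathit{Txs}$ have distinct positions; (ii) every input $i$ in some $tx$ in $\mathit{Txs}$ points to a unique output, denoted $\mathit{Txs}(i)$, in some earlier transaction, and distinct inputs appearing in $\mathit{Txs}$ have distinct positions; (iii) if an input $i=(p,k)$ appears in $tx$ in $\mathit{Txs}$ and points to the earlier output $\mathit{Txs}(i)=(p,V,s,v)$, then $(k,s,v,tx@i)\in V$. Write $\mathrm{valid}(\mathit{Txs})$ for "$\mathit{Txs}$ is a blockchain". The symbol $;$ denotes concatenation of sequences of transactions (a single transaction being treated as a one-element sequence). For any finite sequence of transactions $\mathit{Txs}$, an output appearing in $\mathit{Txs}$ is spent (in $\mathit{Txs}$) when a later input points to it, and otherwise unspent. $\mathrm{UTxO}(\mathit{Txs})$ is the set of unspent outputs in $\mathit{Txs}$. Write $\mathit{Txs}\cong\mathit{Txs}'$ (observational equivalence) when $\mathrm{UTxO}(\mathit{Txs})=\mathrm{UTxO}(\mathit{Txs}')$. *)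

theory Defs
  imports Main
begin

type_synonym redeemer = nat
type_synonym currency_symbol = nat
type_synonym token_name = nat
type_synonym position = nat
type_synonym chip = "currency_symbol \<times> token_name"
type_synonym datum = nat
type_synonym chip_value = "chip \<rightharpoonup> nat"
type_synonym inp = "position \<times> redeemer"
type_synonym 'v outp = "position \<times> 'v \<times> datum \<times> chip_value"
type_synonym 'v tx = "inp set \<times> 'v outp set"
type_synonym 'v ctx = "(inp set \<times> inp) \<times> 'v outp set"

definition Value :: "chip_value set" where
  "Value = {v. finite (dom v) \<and> (\<forall>n\<in>ran v. n > 0)}"

definition Output :: "'v set \<Rightarrow> 'v outp set" where
  "Output Validator = UNIV \<times> Validator \<times> UNIV \<times> Value"

definition Transaction :: "'v set \<Rightarrow> 'v tx set" where
  "Transaction Validator = {(I, Q). finite I \<and> finite Q \<and> Q \<subseteq> Output Validator}"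

definition Context :: "'v set \<Rightarrow> 'v ctx set" where
  "Context Validator = {((I, i), Q) | I i Q. (I, Q) \<in> Transaction Validator \<and> i \<in> I}"

text \<open>
  The type equations are recursive: validators are sets of tuples containing contexts, and contexts
  mention validators. A solution is therefore given by a carrier \<open>Validator\<close>, possibly empty,
  together with an injection \<open>sem\<close> which identifies each validator with a subset of
  \<open>Redeemer \<times> Datum \<times> Value \<times> Context\<close>. The image of \<open>sem\<close> is arbitrary, as the choice of the
  subset \<open>Validator\<close> of the powerset is left open.
\<close>

definition eutxo_solution ::
  "'v set \<Rightarrow> ('v \<Rightarrow> (redeemer \<times> datum \<times> chip_value \<times> 'v ctx) set) \<Rightarrow> bool" where
  "eutxo_solution Validator sem \<longleftrightarrow>
     inj_on sem Validator \<and>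
     sem ` Validator \<subseteq> Pow (UNIV \<times> UNIV \<times> Value \<times> Context Validator)"

definition tx_at :: "'v tx \<Rightarrow> inp \<Rightarrow> 'v ctx" where
  "tx_at t i = ((fst t, i), snd t)"

text \<open>
  An occurrence of an input or output in a sequence is the input or output paired with the index of
  the transaction in which it appears; a smaller index means an earlier transaction.
\<close>

definition inputs :: "'v tx list \<Rightarrow> (nat \<times> inp) set" where
  "inputs Txs = {(n, i). n < length Txs \<and> i \<in> fst (Txs ! n)}"

definition outputs :: "'v tx list \<Rightarrow> (nat \<times> 'v outp) set" where
  "outputs Txs = {(m, q). m < length Txs \<and> q \<in> snd (Txs ! m)}"

definition points_to :: "inp \<Rightarrow> 'v outp \<Rightarrow> bool" where
  "points_to i q \<longleftrightarrow> fst i = fst q"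

definition valid ::
  "'v set \<Rightarrow> ('v \<Rightarrow> (redeemer \<times> datum \<times> chip_value \<times> 'v ctx) set) \<Rightarrow> 'v tx list \<Rightarrow> bool" where
  "valid Validator sem Txs \<longleftrightarrow>
     set Txs \<subseteq> Transaction Validator \<and>
     inj_on (\<lambda>(m, q). fst q) (outputs Txs) \<and>
     (\<forall>(n, i)\<in>inputs Txs. \<exists>!(m, q). (m, q) \<in> outputs Txs \<and> m < n \<and> points_to i q) \<and>
     inj_on (\<lambda>(n, i). fst i) (inputs Txs) \<and>
     (\<forall>n p k m V s v.
        (n, (p, k)) \<in> inputs Txs \<and> (m, (p, V, s, v)) \<in> outputs Txs \<and> m < n \<longrightarrow>
          (k, s, v, tx_at (Txs ! n) (p, k)) \<in> sem V)"

definition spent :: "'v tx list \<Rightarrow> nat \<times> 'v outp \<Rightarrow> bool" where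
  "spent Txs x \<longleftrightarrow> (\<exists>(n, i)\<in>inputs Txs. fst x < n \<and> points_to i (snd x))"

text \<open>
  \<open>UTxO\<close> forgets the index of an occurrence, so that the unspent outputs of different sequences can
  be compared.
\<close>

definition UTxO :: "'v tx list \<Rightarrow> 'v outp set" where
  "UTxO Txs = snd ` {x \<in> outputs Txs. \<not> spent Txs x}"

definition obs_equiv :: "'v tx list \<Rightarrow> 'v tx list \<Rightarrow> bool"  (infix "\<cong>" 50) where
  "Txs \<cong> Txs' \<longleftrightarrow> UTxO Txs = UTxO Txs'"

end

theory Submission
  imports Defs
begin

text \<open>
  Output positions are distinct in a blockchain, so the output to which an input points is determined
  by its position alone, whatever the order of the transactions. Hence a blockchain may be rearranged
  freely as long as every output stays before the input that spends it, and the unspent outputs do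
  not change. When \<open>t\<close> moves to the front of \<open>Txs\<close>, its own inputs are the only ones at risk, and
  validity of \<open>B @ [t]\<close> says that they point into \<open>B\<close>.
\<close>

lemma valid_output_unique:
  assumes "valid Validator sem Xs"
    and "(m, q) \<in> outputs Xs" "(m', q') \<in> outputs Xs" "fst q = fst q'"
  shows "m = m'" "q = q'"
proof -
  have "inj_on (\<lambda>(m, q). fst q) (outputs Xs)"
    using assms(1) by (simp add: valid_def)
  from inj_onD[OF this _ assms(2,3)] assms(4) show "m = m'" "q = q'"
    by simp_all
qed

lemma valid_input_unique:
  assumes "valid Validator sem Xs"
    and "(n, i) \<in> inputs Xs" "(n', i') \<in> inputs Xs" "fst i = fst i'"
  shows "n = n'" "i = i'"
proof -
  have "inj_on (\<lambda>(n, i). fst i) (inputs Xs)"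
    using assms(1) by (simp add: valid_def)
  from inj_onD[OF this _ assms(2,3)] assms(4) show "n = n'" "i = i'"
    by simp_all
qed

text \<open>Validity supplies some earlier output at the position of \<open>i\<close>; distinctness
  of output positions forces it to be \<open>q\<close>.\<close>

lemma valid_points_to_earlier:
  assumes val: "valid Validator sem Xs"
    and i: "(n, i) \<in> inputs Xs" and q: "(m, q) \<in> outputs Xs" and pt: "points_to i q"
  shows "m < n"
proof -
  have "\<exists>!(m, q). (m, q) \<in> outputs Xs \<and> m < n \<and> points_to i q"
    using val i unfolding valid_def by fast
  then obtain m' q' where mq: "(m', q') \<in> outputs Xs" "m' < n" "points_to i q'"
    by auto
  then show ?thesis
    using valid_output_unique(1)[OF val mq(1) q] pt by (simp add: points_to_def)
qed

text \<open>In this form being spent refers to positions only, so it can be compared between two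
  orderings of the same transactions.\<close>

lemma valid_spent_iff:
  assumes "valid Validator sem Xs" and "x \<in> outputs Xs"
  shows "spent Xs x \<longleftrightarrow> (\<exists>(n, i)\<in>inputs Xs. points_to i (snd x))"
  using valid_points_to_earlier[OF assms(1), of _ _ "fst x" "snd x"] assms(2)
  unfolding spent_def by fastforce

text \<open>The map \<open>f\<close> sends the index of a transaction in \<open>Xs\<close> to its
  index in \<open>Ys\<close>. Tracking indices, rather than comparing multisets, transports
  occurrences even when a transaction is repeated.\<close>

locale rearrangement =
  fixes f :: "nat \<Rightarrow> nat" and Xs Ys :: "'v tx list"
  assumes bij: "bij_betw f {..<length Xs} {..<length Ys}"
    and nth: "\<And>n. n < length Xs \<Longrightarrow> Ys ! f n = Xs ! n"
begin

lemma set_eq: "set Ys = set Xs"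
proof -
  have "set Ys = (!) Ys ` f ` {..<length Xs}"
    using bij by (auto simp: bij_betw_def set_conv_nth)
  also have "\<dots> = set Xs"
    using nth by (force simp: set_conv_nth image_iff)
  finally show ?thesis .
qed

lemma index_iff: "k < length Ys \<longleftrightarrow> (\<exists>n<length Xs. k = f n)"
  using bij by (auto simp: bij_betw_def)

lemma inputs_eq: "inputs Ys = map_prod f id ` inputs Xs"
  by (force simp: inputs_def index_iff nth)

lemma outputs_eq: "outputs Ys = map_prod f id ` outputs Xs"
  by (force simp: outputs_def index_iff nth)

text \<open>Positions and contexts do not change under \<open>f\<close>; only the clause that
  outputs precede the inputs pointing to them depends on the order, and \<open>order\<close>
  provides it.\<close>

lemma valid_and_obs_equiv:
  assumes val: "valid Validator sem Xs"
    and order: "\<And>n i m q. (n, i) \<in> inputs Xs \<Longrightarrow> (m, q) \<in> outputs Xs \<Longrightarrow> points_to i q \<Longrightarrow> f m < f n"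
  shows "valid Validator sem Ys" and "Ys \<cong> Xs"
proof -
  have trans: "set Ys \<subseteq> Transaction Validator"
    using val by (simp add: valid_def set_eq)
  have injO: "inj_on (\<lambda>(m, q). fst q) (outputs Ys)"
    by (auto simp: outputs_eq intro!: inj_onI dest: valid_output_unique[OF val])
  have injI: "inj_on (\<lambda>(n, i). fst i) (inputs Ys)"
    by (auto simp: inputs_eq intro!: inj_onI dest: valid_input_unique[OF val])
  have ex1: "\<exists>!(m, q). (m, q) \<in> outputs Ys \<and> m < n \<and> points_to i q"
    if "(n, i) \<in> inputs Ys" for n i
  proof -
    from that obtain n' where n': "(n', i) \<in> inputs Xs" "n = f n'"
      by (auto simp: inputs_eq)
    then have "\<exists>!(m, q). (m, q) \<in> outputs Xs \<and> m < n' \<and> points_to i q"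
      using val unfolding valid_def by fast
    then obtain m q where mq: "(m, q) \<in> outputs Xs" "points_to i q"
      by auto
    have fm: "(f m, q) \<in> outputs Ys" "f m < n"
      using order[OF n'(1) mq] n'(2) mq(1) by (auto simp: outputs_eq intro: rev_image_eqI)
    show ?thesis
    proof (rule ex1I[of _ "(f m, q)"])
      show "case (f m, q) of (m, q) \<Rightarrow> (m, q) \<in> outputs Ys \<and> m < n \<and> points_to i q"
        using fm mq(2) by simp
      show "x = (f m, q)" if "case x of (m, q) \<Rightarrow> (m, q) \<in> outputs Ys \<and> m < n \<and> points_to i q" for x
        using that fm(1) mq(2) by (intro inj_onD[OF injO]) (auto simp: points_to_def)
    qed
  qed
  \<comment> \<open>As \<open>f\<close> need not be monotone, the order of \<open>m\<close> and
    \<open>n\<close> says nothing about their preimages; \<open>m' < n'\<close> comes from the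
    shared position \<open>p\<close>.\<close>
  have sem: "(k, s, v, tx_at (Ys ! n) (p, k)) \<in> sem V"
    if "(n, (p, k)) \<in> inputs Ys" "(m, (p, V, s, v)) \<in> outputs Ys" for n p k m V s v
  proof -
    from that obtain n' m' where
      *: "(n', (p, k)) \<in> inputs Xs" "n = f n'" "(m', (p, V, s, v)) \<in> outputs Xs"
      by (auto simp: inputs_eq outputs_eq)
    then have "m' < n'"
      using valid_points_to_earlier[OF val] by (simp add: points_to_def)
    moreover have "Ys ! n = Xs ! n'"
      using * nth by (simp add: inputs_def)
    moreover have "(n, (p, k)) \<in> inputs Xs \<and> (m, (p, V, s, v)) \<in> outputs Xs \<and> m < n \<longrightarrow>
        (k, s, v, tx_at (Xs ! n) (p, k)) \<in> sem V" for n m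
      using val unfolding valid_def by (elim conjE allE)
    ultimately show ?thesis
      using * by simp
  qed
  show valY: "valid Validator sem Ys"
    unfolding valid_def
  proof (intro conjI allI impI trans injO injI)
    show "\<forall>(n, i)\<in>inputs Ys. \<exists>!(m, q). (m, q) \<in> outputs Ys \<and> m < n \<and> points_to i q"
      using ex1 by (intro ballI) (simp only: split_paired_all prod.case)
  qed (elim conjE, rule sem)
  have "spent Ys (f m, q) \<longleftrightarrow> spent Xs (m, q)" if "(m, q) \<in> outputs Xs" for m q
  proof -
    have "(f m, q) \<in> outputs Ys"
      using that by (auto simp: outputs_eq intro: rev_image_eqI)
    then show ?thesis
      using valid_spent_iff[OF valY] valid_spent_iff[OF val] that by (simp add: inputs_eq split_beta)
  qed
  then have "{x \<in> outputs Ys. \<not> spent Ys x} = map_prod f id ` {x \<in> outputs Xs. \<not> spent Xs x}"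
    unfolding outputs_eq by (auto intro: rev_image_eqI)
  then show "Ys \<cong> Xs"
    by (simp add: obs_equiv_def UTxO_def image_image)
qed

end

theorem theorem2p17:
  fixes Validator :: "'v set"
    and sem :: "'v \<Rightarrow> (redeemer \<times> datum \<times> chip_value \<times> 'v ctx) set"
    and B Txs :: "'v tx list"
    and t :: "'v tx"
  assumes "eutxo_solution Validator sem"
    and "valid Validator sem B"
    and "set Txs \<subseteq> Transaction Validator"
    and "t \<in> Transaction Validator"
    and "valid Validator sem (B @ Txs @ [t])"
    and "valid Validator sem (B @ [t])"
  shows "valid Validator sem (B @ [t] @ Txs) \<and> B @ [t] @ Txs \<cong> B @ Txs @ [t]"
proof -
  let ?X = "B @ Txs @ [t]" and ?Y = "B @ [t] @ Txs"
  let ?b = "length B" and ?l = "length Txs"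
  \<comment> \<open>\<open>B\<close> stays in place, \<open>t\<close> moves from the last index
    \<open>?b + ?l\<close> to \<open>?b\<close>, and each transaction of \<open>Txs\<close> shifts
    up by one.\<close>
  define f where "f n = (if n < ?b then n else if n = ?b + ?l then ?b else Suc n)" for n
  interpret rearrangement f ?X ?Y
  proof
    have inj: "inj_on f {..<length ?X}"
      by (auto simp: inj_on_def f_def split: if_splits)
    have "f ` {..<length ?X} \<subseteq> {..<length ?Y}"
      by (auto simp: f_def)
    \<comment> \<open>Surjectivity by counting: \<open>?X\<close> and \<open>?Y\<close> have equal
      length and \<open>f\<close> is injective.\<close>
    then have "f ` {..<length ?X} = {..<length ?Y}"
      by (intro card_subset_eq) (auto simp: card_image[OF inj, simplified])
    with inj show "bij_betw f {..<length ?X} {..<length ?Y}"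
      by (simp add: bij_betw_def)
    show "?Y ! f n = ?X ! n" if "n < length ?X" for n
      using that by (auto simp: f_def nth_append Suc_diff_le)
  qed
  have "f m < f n"
    if i: "(n, i) \<in> inputs ?X" and q: "(m, q) \<in> outputs ?X" and pt: "points_to i q" for n i m q
  proof (cases "n = ?b + ?l")
    case True
    \<comment> \<open>Here \<open>i\<close> belongs to \<open>t\<close>, which has index
      \<open>?b\<close> in \<open>B @ [t]\<close>. The output found there lies in \<open>B\<close>,
      hence also occurs in \<open>?X\<close> at the same index, and uniqueness in \<open>?X\<close>
      gives \<open>m < ?b\<close>.\<close>
    then have "(?b, i) \<in> inputs (B @ [t])"
      using i by (simp add: inputs_def nth_append)
    then have "\<exists>!(m, q). (m, q) \<in> outputs (B @ [t]) \<and> m < ?b \<and> points_to i q"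
      using assms(6) unfolding valid_def by fast
    then obtain m' q' where m': "(m', q') \<in> outputs (B @ [t])" "m' < ?b" "points_to i q'"
      by auto
    then have "(m', q') \<in> outputs ?X"
      by (simp add: outputs_def nth_append)
    then have "m = m'"
      using valid_output_unique(1)[OF assms(5) q] pt m'(3) by (simp add: points_to_def)
    then show ?thesis
      using m'(2) True by (simp add: f_def)
  next
    case False
    \<comment> \<open>Below \<open>?b + ?l\<close> the map \<open>f\<close> is strictly increasing,
      so the order in \<open>?X\<close> is kept.\<close>
    moreover have "m < n"
      using valid_points_to_earlier[OF assms(5) i q pt] .
    moreover have "n < Suc (?b + ?l)"
      using i by (simp add: inputs_def)
    ultimately show ?thesis
      by (auto simp: f_def)
  qed
  then show ?thesis
    using valid_and_obs_equiv[OF assms(5)] by blast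
qed

end
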